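(* Let $f(z)=z+a_2z^2+a_3z^3+\cdots\in\mathcal{S}^{*}_{\arcsin}$. Then the second Hankel determinant $H_{2,2}(f)=a_2a_4-a_3^2$ satisfies $$|H_{2,2}(f)|\le \frac{1}{\pi^2}.$$
   Context: Let $\Omega=\{z\in\mathbb{C}:|z|<1\}$. Let $\mathcal{A}$ be the family of analytic functions $f$ on $\Omega$ normalized by $f(z)=z+\sum_{n\ge 2}a_nz^n$, and let $\mathcal{S}\subset\mathcal{A}$ be the subclass of univalent (injective) functions. A Schwarz function is an analytic function $\omega$ on $\Omega$ with $\omega(0)=0$ and $|\omega(z)|\le 1$ for all $z\in\Omega$. For $g,h$ analytic in $\Omega$, $g\prec h$ ($g$ is subordinate to $h$) means there is a Schwarz function $\omega$ with $g(z)=h(\omega(z))$ for all $z\in\Omega$. With $\arcsin$ denoting the principal branch (analytic in $\Omega$, $\arcsin 0=0$), define $$\mathcal{S}^{*}_{\arcsin}=\left\{f\in\mathcal{S}:\ \frac{zf'(z)}{f(z)}\prec 1+\frac{2}{\pi}\arcsin z\right\},$$ where $zf'(z)/f(z)$ is understood to take the value $1$ at $z=0$. *)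

theory Defs
  imports "HOL-Complex_Analysis.Complex_Analysis"
begin

abbreviation unit_disc :: "complex set" where
  "unit_disc \<equiv> ball 0 1"

definition taylor_coeff :: "(complex \<Rightarrow> complex) \<Rightarrow> nat \<Rightarrow> complex" where
  "taylor_coeff f n = fps_nth (fps_expansion f 0) n"

text \<open>Functions are total on the type of complex numbers; values outside the disc are
  irrelevant, and no condition is imposed on them.\<close>

definition class_A :: "(complex \<Rightarrow> complex) set" where
  "class_A = {f. f holomorphic_on unit_disc \<and> taylor_coeff f 0 = 0 \<and> taylor_coeff f 1 = 1}"

definition class_S :: "(complex \<Rightarrow> complex) set" where
  "class_S = {f \<in> class_A. inj_on f unit_disc}"

definition schwarz_function :: "(complex \<Rightarrow> complex) \<Rightarrow> bool" where
  "schwarz_function \<omega> \<longleftrightarrow>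
     \<omega> holomorphic_on unit_disc \<and> \<omega> 0 = 0 \<and> (\<forall>z\<in>unit_disc. norm (\<omega> z) \<le> 1)"

text \<open>The non-strict bound in the definition of a Schwarz function implies the strict one on the
  disc (maximum principle), so only values of \<open>h\<close> inside the disc are used here.
  Subordination is only meant for \<open>g\<close> and \<open>h\<close> holomorphic on the disc.\<close>

definition subordinate :: "(complex \<Rightarrow> complex) \<Rightarrow> (complex \<Rightarrow> complex) \<Rightarrow> bool"
    (infix "\<prec>\<^sub>s" 50) where
  "g \<prec>\<^sub>s h \<longleftrightarrow> (\<exists>\<omega>. schwarz_function \<omega> \<and> (\<forall>z\<in>unit_disc. g z = h (\<omega> z)))"

definition starlike_quotient :: "(complex \<Rightarrow> complex) \<Rightarrow> complex \<Rightarrow> complex" where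
  "starlike_quotient f z = (if z = 0 then 1 else z * deriv f z / f z)"

definition S_star_arcsin :: "(complex \<Rightarrow> complex) set" where
  "S_star_arcsin =
     {f \<in> class_S. starlike_quotient f \<prec>\<^sub>s (\<lambda>z. 1 + 2 / of_real pi * Arcsin z)}"

definition hankel_2_2 :: "(complex \<Rightarrow> complex) \<Rightarrow> complex" where
  "hankel_2_2 f = taylor_coeff f 2 * taylor_coeff f 4 - (taylor_coeff f 3)\<^sup>2"

end

(*
  Comparing coefficients in z f' = f (1 + b P) with b = 2/pi and P = Arcsin o omega expresses the
  Hankel determinant through the first three coefficients c1, c2, c3 of the Schwarz function omega:
  pi^2 H = 4/3 c1 c3 - c2^2 + k c1^4 with k = 2/9 - 4/(3 pi^2).
  The Schur algorithm (iterated Schwarz lemma) parametrises c2 = (1 - |c1|^2) x and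
  c3 = (1 - |c1|^2) (y - cnj c1 x^2) with |x| <= 1 and |y| <= 1 - |x|^2. By the triangle inequality
  and 0 <= k <= 1/3, the bound reduces to the real inequality
  (1 - |x|^2) (1 - |c1|) (3 - |c1|) >= 0.
*)

theory Submission
  imports Defs
begin

unbundle no vec_syntax

section \<open>The Schur algorithm for functions bounded by 1\<close>

text \<open>The product form, rather than the quotient
  \<open>z * h z = (g z - g 0) / (1 - cnj (g 0) * g z)\<close>, also covers unimodular constants \<open>g\<close> (with
  \<open>h = 0\<close>).\<close>

lemma schur_step:
  fixes g :: "complex \<Rightarrow> complex"
  assumes holg: "g holomorphic_on unit_disc" and bg: "\<And>z. z \<in> unit_disc \<Longrightarrow> norm (g z) \<le> 1"
  obtains h :: "complex \<Rightarrow> complex" where "h holomorphic_on unit_disc" "\<And>z. z \<in> unit_disc \<Longrightarrow> norm (h z) \<le> 1"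
    "\<And>z. z \<in> unit_disc \<Longrightarrow> g z - g 0 = z * h z * (1 - cnj (g 0) * g z)"
\<comment> \<open>If \<open>g\<close> attains modulus 1 inside the disc, the maximum principle makes
  it constant. Otherwise \<open>g\<close> maps into the open disc, on which the Moebius map is
  holomorphic.\<close>
proof (cases "\<exists>a\<in>unit_disc. norm (g a) = 1")
  case True
  then obtain a where a: "a \<in> unit_disc" "norm (g a) = 1" by blast
  have "g constant_on unit_disc"
    by (rule maximum_modulus_principle[OF holg _ _ _ subset_refl a(1)]) (use a bg in auto)
  then obtain c where "\<And>z. z \<in> unit_disc \<Longrightarrow> g z = c"
    by (auto simp: constant_on_def)
  then show thesis
    by (intro that[of "\<lambda>_. 0"]) auto
next
  case False
  then have lt: "norm (g z) < 1" if "z \<in> unit_disc" for z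
    using bg[OF that] that by force
  have lt0: "norm (g 0) < 1"
    by (simp add: lt)
  \<comment> \<open>Moving the value \<open>g 0\<close> to the origin brings \<open>\<phi>\<close>
    under the Schwarz lemma; \<open>h\<close> is then the quotient of \<open>\<phi> z\<close> by
    \<open>z\<close>, extended by the derivative at 0.\<close>
  define \<phi> where "\<phi> = Moebius_function 0 (g 0) \<circ> g"
  have hol\<phi>: "\<phi> holomorphic_on ball 0 1"
    unfolding \<phi>_def
    by (rule holomorphic_on_compose_gen[OF holg Moebius_function_holomorphic[OF lt0]])
      (use lt in auto)
  have \<phi>0: "\<phi> 0 = 0"
    by (simp add: \<phi>_def Moebius_function_eq_zero)
  have \<phi>lt: "norm (\<phi> z) < 1" if "norm z < 1" for z
    using that by (simp add: \<phi>_def Moebius_function_norm_lt_1 lt)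
  obtain h :: "complex \<Rightarrow> complex" where h: "h holomorphic_on ball 0 1" "\<And>z. norm z < 1 \<Longrightarrow> \<phi> z = z * h z"
    "deriv \<phi> 0 = h 0"
    using Schwarz3[OF hol\<phi> \<phi>0] by blast
  show thesis
  proof (rule that[of h])
    show "norm (h z) \<le> 1" if z: "z \<in> unit_disc" for z
    proof (cases "z = 0")
      case True
      then show ?thesis
        using Schwarz_Lemma(2)[OF hol\<phi> \<phi>0 \<phi>lt, of 0] h(3) by simp
    next
      case False
      then show ?thesis
        using Schwarz_Lemma(1)[OF hol\<phi> \<phi>0 \<phi>lt, of z] h(2)[of z] z by (simp add: norm_mult)
    qed
    show "g z - g 0 = z * h z * (1 - cnj (g 0) * g z)" if z: "z \<in> unit_disc" for z
    proof -
      have "norm (cnj (g 0) * g z) < 1"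
        using lt0 lt[OF z] norm_mult_less[of "cnj (g 0)" 1 "g z" 1] by simp
      then have "1 - cnj (g 0) * g z \<noteq> 0" by auto
      moreover have "(g z - g 0) / (1 - cnj (g 0) * g z) = z * h z"
        using h(2)[of z] z by (simp add: \<phi>_def Moebius_function_simple)
      ultimately show ?thesis by (simp add: divide_eq_eq)
    qed
  qed (rule h)
qed

lemma fps_expansion_unit_disc:
  "g holomorphic_on unit_disc \<Longrightarrow> g has_fps_expansion fps_expansion g 0"
  by (rule has_fps_expansion_fps_expansion[of unit_disc]) auto

lemma fps_expansion_eq_near_0:
  fixes F G :: "complex fps"
  assumes "f has_fps_expansion F" "g has_fps_expansion G" "eventually (\<lambda>z. f z = g z) (nhds 0)"
  shows "F = G"
  using assms fps_expansion_unique_complex has_fps_expansion_cong by blast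

lemma taylor_coeff_0: "taylor_coeff g 0 = g 0"
  by (simp add: taylor_coeff_def fps_expansion_def)

text \<open>Numerals are turned into successors so that convolution sums unfold into explicit
  terms.\<close>

lemmas fps_coeff_simps = fps_mult_nth fps_compose_nth fps_X_nth
  eval_nat_numeral atLeast0AtMost atMost_Suc

text \<open>Compares the coefficients of \<open>z\<close>, \<open>z^2\<close> and \<open>z^3\<close>
  in the product identity of \<open>schur_step\<close>. If \<open>g 0 = 0\<close>, that identity
  reads \<open>g z = z * h z\<close>, a mere index shift.\<close>

lemma schur_step_coeffs:
  fixes g :: "complex \<Rightarrow> complex"
  assumes "g holomorphic_on unit_disc" "\<And>z. z \<in> unit_disc \<Longrightarrow> norm (g z) \<le> 1"
  obtains h :: "complex \<Rightarrow> complex" where "h holomorphic_on unit_disc" "\<And>z. z \<in> unit_disc \<Longrightarrow> norm (h z) \<le> 1"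
    "taylor_coeff g 1 = (1 - (norm (g 0))\<^sup>2) * h 0"
    "taylor_coeff g 2 = (1 - (norm (g 0))\<^sup>2) * taylor_coeff h 1 - cnj (g 0) * taylor_coeff g 1 * h 0"
    "g 0 = 0 \<Longrightarrow> taylor_coeff g 3 = taylor_coeff h 2"
proof -
  obtain h :: "complex \<Rightarrow> complex" where h: "h holomorphic_on unit_disc"
    "\<And>z. z \<in> unit_disc \<Longrightarrow> norm (h z) \<le> 1"
    "\<And>z. z \<in> unit_disc \<Longrightarrow> g z - g 0 = z * h z * (1 - cnj (g 0) * g z)"
    using schur_step[OF assms] by blast
  define G H where "G = fps_expansion g 0" and "H = fps_expansion h 0"
  have G: "g has_fps_expansion G" and H: "h has_fps_expansion H"
    unfolding G_def H_def by (intro fps_expansion_unit_disc assms h)+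
  have ev: "\<forall>\<^sub>F z in nhds 0. z \<in> unit_disc"
    by (rule eventually_nhds_in_open) auto
  have "G - fps_const (g 0) = fps_X * H * (1 - fps_const (cnj (g 0)) * G)"
  proof (rule fps_expansion_eq_near_0)
    show "(\<lambda>z. g z - g 0) has_fps_expansion G - fps_const (g 0)"
      by (intro fps_expansion_intros G)
    show "(\<lambda>z. z * h z * (1 - cnj (g 0) * g z)) has_fps_expansion
        fps_X * H * (1 - fps_const (cnj (g 0)) * G)"
      by (intro fps_expansion_intros G H)
    show "\<forall>\<^sub>F z in nhds 0. g z - g 0 = z * h z * (1 - cnj (g 0) * g z)"
      using ev by eventually_elim (rule h)
  qed
  then have eq: "(G - fps_const (g 0)) $ n = (fps_X * H * (1 - fps_const (cnj (g 0)) * G)) $ n" for n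
    by simp
  have G0: "G $ 0 = g 0" and H0: "H $ 0 = h 0"
    using taylor_coeff_0 by (simp_all add: G_def H_def taylor_coeff_def)
  have sq: "complex_of_real ((norm (g 0))\<^sup>2) = cnj (g 0) * g 0"
    by (simp add: complex_norm_square mult.commute del: of_real_power)
  have G1: "G $ 1 = (1 - cnj (g 0) * g 0) * h 0"
    using eq[of 1] by (simp add: fps_coeff_simps G0 H0)
  have G2: "G $ 2 = (1 - cnj (g 0) * g 0) * H $ 1 - cnj (g 0) * G $ 1 * h 0"
    using eq[of 2] by (simp add: fps_coeff_simps G0 H0)
  have G3: "G $ 3 = H $ 2" if "g 0 = 0"
    using eq[of 3] that by (simp add: fps_coeff_simps)
  show thesis
    by (rule that[OF h(1,2)]) (use G1 G2 G3 in \<open>simp_all add: taylor_coeff_def G_def H_def sq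
      del: of_real_power\<close>)
qed

text \<open>Three Schur steps lead from \<omega> through \<open>g\<close> and \<open>h\<close> to
  \<open>k\<close>, all bounded by 1. The parameters are \<open>x = h 0\<close> and the linear
  coefficient \<open>y\<close> of \<open>h\<close>; the bound on \<open>y\<close> is
  \<open>norm (k 0) \<le> 1\<close>.\<close>

lemma schwarz_function_coeffs:
  assumes "schwarz_function \<omega>"
  obtains x y :: complex where "norm (taylor_coeff \<omega> 1) \<le> 1" "norm x \<le> 1" "norm y \<le> 1 - (norm x)\<^sup>2"
    "taylor_coeff \<omega> 2 = (1 - (norm (taylor_coeff \<omega> 1))\<^sup>2) * x"
    "taylor_coeff \<omega> 3 = (1 - (norm (taylor_coeff \<omega> 1))\<^sup>2) * (y - cnj (taylor_coeff \<omega> 1) * x\<^sup>2)"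
proof -
  have \<omega>: "\<omega> holomorphic_on unit_disc" "\<And>z. z \<in> unit_disc \<Longrightarrow> norm (\<omega> z) \<le> 1" "\<omega> 0 = 0"
    using assms by (auto simp: schwarz_function_def)
  obtain g :: "complex \<Rightarrow> complex" where g: "g holomorphic_on unit_disc"
    "\<And>z. z \<in> unit_disc \<Longrightarrow> norm (g z) \<le> 1"
    "taylor_coeff \<omega> 1 = g 0" "taylor_coeff \<omega> 2 = taylor_coeff g 1"
    "taylor_coeff \<omega> 3 = taylor_coeff g 2"
    \<comment> \<open>Since \<omega> vanishes at 0, this first step only divides by
      \<open>z\<close>.\<close>
    by (rule schur_step_coeffs[OF \<omega>(1,2)]) (use \<omega>(3) in auto)
  obtain h :: "complex \<Rightarrow> complex" where h: "h holomorphic_on unit_disc"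
    "\<And>z. z \<in> unit_disc \<Longrightarrow> norm (h z) \<le> 1"
    "taylor_coeff g 1 = (1 - (norm (g 0))\<^sup>2) * h 0"
    "taylor_coeff g 2 = (1 - (norm (g 0))\<^sup>2) * taylor_coeff h 1 - cnj (g 0) * taylor_coeff g 1 * h 0"
    by (rule schur_step_coeffs[OF g(1,2)]) (assumption, rule that)
  obtain k :: "complex \<Rightarrow> complex" where k: "\<And>z. z \<in> unit_disc \<Longrightarrow> norm (k z) \<le> 1"
    "taylor_coeff h 1 = (1 - (norm (h 0))\<^sup>2) * k 0"
    by (rule schur_step_coeffs[OF h(1,2)]) (assumption, rule that)
  have h0: "norm (h 0) \<le> 1" and k0: "norm (k 0) \<le> 1"
    by (simp_all add: h k)
  show thesis
  proof (rule that[of "h 0" "taylor_coeff h 1"])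
    have nn: "0 \<le> 1 - (norm (h 0))\<^sup>2"
      using h0 by (simp add: abs_square_le_1)
    have "norm (taylor_coeff h 1) = (1 - (norm (h 0))\<^sup>2) * norm (k 0)"
      unfolding k(2) norm_mult norm_of_real using nn by simp
    also have "\<dots> \<le> 1 - (norm (h 0))\<^sup>2"
      using mult_left_mono[OF k0 nn] by simp
    finally show "norm (taylor_coeff h 1) \<le> 1 - (norm (h 0))\<^sup>2" .
    show "taylor_coeff \<omega> 2 = (1 - (norm (taylor_coeff \<omega> 1))\<^sup>2) * h 0"
      unfolding g h by simp
    show "taylor_coeff \<omega> 3 = (1 - (norm (taylor_coeff \<omega> 1))\<^sup>2)
        * (taylor_coeff h 1 - cnj (taylor_coeff \<omega> 1) * (h 0)\<^sup>2)"
      unfolding g h by (simp add: algebra_simps power2_eq_square)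
  qed (use g h0 in auto)
qed

section \<open>The estimate of the coefficient functional\<close>

lemma schwarz_functional_bound:
  fixes c x y :: complex and k :: real
  assumes c: "norm c \<le> 1" and x: "norm x \<le> 1" and y: "norm y \<le> 1 - (norm x)\<^sup>2"
    and k: "0 \<le> k" "k \<le> 1/3"
    and c2: "c2 = (1 - (norm c)\<^sup>2) * x"
    and c3: "c3 = (1 - (norm c)\<^sup>2) * (y - cnj c * x\<^sup>2)"
  shows "norm (4/3 * c * c3 - c2\<^sup>2 + k * c ^ 4) \<le> 1"
proof -
  define r s t where "r = norm c" and "s = (norm x)\<^sup>2" and "t = 1 - r\<^sup>2"
  have r: "0 \<le> r" "r \<le> 1" and s: "0 \<le> s" and t: "0 \<le> t"
    using c by (auto simp: r_def s_def t_def abs_square_le_1)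
  have sq: "c * cnj c = complex_of_real (r\<^sup>2)"
    by (simp add: r_def complex_norm_square del: of_real_power)
  \<comment> \<open>The factor \<open>c * cnj c\<close> is real, so the \<open>x^2\<close> terms of
    \<open>c3\<close> and of \<open>c2^2\<close> merge into one term with a nonnegative coefficient
    before the triangle inequality is applied.\<close>
  have rearrange: "a * c * (T * (y - cnj c * x\<^sup>2)) - (T * x)\<^sup>2 + K
      = a * T * (c * y) - a * T * (c * cnj c) * x\<^sup>2 - T\<^sup>2 * x\<^sup>2 + K" for a T K :: complex
    by (simp add: algebra_simps power_mult_distrib)
  have "4/3 * c * c3 - c2\<^sup>2 + k * c ^ 4 =
      of_real (4/3 * t) * (c * y) - of_real (4/3 * t) * (c * cnj c) * x\<^sup>2 - of_real (t\<^sup>2) * x\<^sup>2 + of_real k * c ^ 4"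
    using rearrange[of "4/3" "of_real t"] unfolding c2 c3 t_def r_def by simp
  also have "\<dots> = of_real (4/3 * t) * (c * y) - of_real (4/3 * t * r\<^sup>2 + t\<^sup>2) * x\<^sup>2 + of_real k * c ^ 4"
    unfolding sq by (simp add: algebra_simps)
  also have "norm \<dots> \<le> norm (of_real (4/3 * t) * (c * y)) + norm (of_real (4/3 * t * r\<^sup>2 + t\<^sup>2) * x\<^sup>2)
      + norm (of_real k * c ^ 4)"
    by (rule order_trans[OF norm_triangle_ineq add_right_mono[OF norm_triangle_ineq4]])
  also have "\<dots> = 4/3 * t * (r * norm y) + (4/3 * t * r\<^sup>2 + t\<^sup>2) * s + k * r ^ 4"
    unfolding norm_mult norm_of_real norm_power using t k r by (simp add: r_def s_def)
  also have "\<dots> \<le> 4/3 * t * (r * (1 - s)) + (4/3 * t * r\<^sup>2 + t\<^sup>2) * s + 1/3 * r ^ 4"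
    using t k r y by (intro add_mono mult_left_mono mult_right_mono) (auto simp: s_def)
  \<comment> \<open>The left side is affine in \<open>s\<close>. At \<open>s = 1\<close> it equals
    \<open>1 - 2/3 * r^2\<close>, because with \<open>1/3\<close> in place of \<open>k\<close> the
    \<open>r^4\<close> terms cancel there; its slope is
    \<open>t * (1 - r) * (3 - r) / 3\<close>.\<close>
  also have "\<dots> = 1 - t * ((1 - s) * (1 - r) * (3 - r)) / 3 - 2/3 * r\<^sup>2"
    unfolding t_def by (simp add: algebra_simps power2_eq_square power4_eq_xxxx
        add_divide_distrib diff_divide_distrib)
  also have "\<dots> \<le> 1"
  proof -
    have "s \<le> 1"
      using x by (simp add: s_def abs_square_le_1)
    then have "0 \<le> t * ((1 - s) * (1 - r) * (3 - r))"
      using t r by simp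
    then show ?thesis
      using zero_le_power2[of r] by linarith
  qed
  finally show ?thesis .
qed

section \<open>From the Schwarz function to the Hankel determinant\<close>

text \<open>As \<open>Arcsin w = w + w^3/6 + ...\<close> and \<omega> vanishes at 0, the composition
  first differs from \<omega> in the cubic coefficient.\<close>

lemma Arcsin_schwarz_coeffs:
  fixes P :: "complex fps"
  assumes "schwarz_function \<omega>"
  defines "P \<equiv> fps_expansion (Arcsin \<circ> \<omega>) 0"
  shows "(Arcsin \<circ> \<omega>) has_fps_expansion P" "P $ 0 = 0" "P $ 1 = taylor_coeff \<omega> 1"
    "P $ 2 = taylor_coeff \<omega> 2" "P $ 3 = taylor_coeff \<omega> 3 + taylor_coeff \<omega> 1 ^ 3 / 6"
proof -
  have \<omega>: "\<omega> holomorphic_on unit_disc" "\<omega> 0 = 0"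
    using assms by (auto simp: schwarz_function_def)
  have "\<bar>Re z\<bar> < 1" if "z \<in> unit_disc" for z :: complex
    using that abs_Re_le_cmod[of z] by simp
  then have "Arcsin analytic_on unit_disc"
    by (auto simp: analytic_on_open intro: holomorphic_on_Arcsin)
  then have an: "Arcsin analytic_on {\<omega> 0}"
    by (rule analytic_on_subset) (simp add: \<omega>)
  have "\<omega> analytic_on {0}"
    unfolding analytic_at using \<omega>(1) by (intro exI[of _ unit_disc]) auto
  then have "(Arcsin \<circ> \<omega>) analytic_on {0}"
    by (rule analytic_on_compose) (use an in auto)
  then show P: "(Arcsin \<circ> \<omega>) has_fps_expansion P"
    unfolding P_def by (rule analytic_at_imp_has_fps_expansion_0)
  show P0: "P $ 0 = 0"
    using taylor_coeff_0[of "Arcsin \<circ> \<omega>"] \<omega> by (simp add: P_def taylor_coeff_def)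
  \<comment> \<open>Composing with \<open>sin\<close> avoids the Taylor expansion of \<open>Arcsin\<close>.\<close>
  have "(sin \<circ> (Arcsin \<circ> \<omega>)) has_fps_expansion (fps_sin 1 oo P)"
    by (intro has_fps_expansion_compose has_fps_expansion_sin' P P0)
  moreover have "sin \<circ> (Arcsin \<circ> \<omega>) = \<omega>"
    by auto
  ultimately have "fps_expansion \<omega> 0 = fps_sin 1 oo P"
    by (simp add: fps_expansion_eqI)
  then have eq: "taylor_coeff \<omega> n = (fps_sin 1 oo P) $ n" for n
    by (simp add: taylor_coeff_def)
  \<comment> \<open>The indices are written with \<open>Suc\<close> to match the terms left by
    \<open>fps_coeff_simps\<close>.\<close>
  have sin_coeffs: "fps_sin (1::complex) $ Suc (Suc 0) = 0"
      "fps_sin (1::complex) $ Suc (Suc (Suc 0)) = - 1 / 6"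
    using fps_sin_nth_add_2[of "1::complex" 0] fps_sin_nth_add_2[of "1::complex" 1]
    by (simp_all add: eval_nat_numeral)
  show P1: "P $ 1 = taylor_coeff \<omega> 1"
    unfolding eq by (simp add: fps_coeff_simps P0)
  show "P $ 2 = taylor_coeff \<omega> 2"
    unfolding eq using P0 by (simp add: fps_coeff_simps sin_coeffs)
  have "taylor_coeff \<omega> 3 = P $ 3 - (P $ 1) ^ 3 / 6"
    unfolding eq using P0 by (simp add: fps_coeff_simps sin_coeffs)
  then show "P $ 3 = taylor_coeff \<omega> 3 + taylor_coeff \<omega> 1 ^ 3 / 6"
    unfolding P1 by simp
qed

text \<open>Univalence and \<open>f 0 = 0\<close> give \<open>f z \<noteq> 0\<close> away from the
  origin, so the denominator of the starlike quotient can be cleared; at 0 both sides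
  vanish.\<close>

lemma S_star_arcsin_expansion:
  assumes "f \<in> S_star_arcsin"
  obtains \<omega> where "schwarz_function \<omega>"
    "fps_X * fps_deriv (fps_expansion f 0) =
       fps_expansion f 0 * (1 + fps_const (2 / of_real pi) * fps_expansion (Arcsin \<circ> \<omega>) 0)"
proof -
  obtain \<omega> where \<omega>: "schwarz_function \<omega>"
    "\<And>z. z \<in> unit_disc \<Longrightarrow> starlike_quotient f z = 1 + 2 / of_real pi * Arcsin (\<omega> z)"
    using assms by (auto simp: S_star_arcsin_def subordinate_def)
  have f: "f holomorphic_on unit_disc" "inj_on f unit_disc" "f 0 = 0"
    using assms taylor_coeff_0[of f] by (auto simp: S_star_arcsin_def class_S_def class_A_def)
  have ode: "z * deriv f z = f z * (1 + 2 / of_real pi * (Arcsin \<circ> \<omega>) z)" if z: "z \<in> unit_disc" for z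
  proof (cases "z = 0")
    case False
    then have "f z \<noteq> 0"
      using inj_onD[OF f(2), of z 0] f(3) z by auto
    then show ?thesis
      using \<omega>(2)[OF z] False by (simp add: starlike_quotient_def field_simps)
  qed (simp add: f)
  note F = fps_expansion_unit_disc[OF f(1)] and P = Arcsin_schwarz_coeffs(1)[OF \<omega>(1)]
  have "fps_X * fps_deriv (fps_expansion f 0) =
       fps_expansion f 0 * (1 + fps_const (2 / of_real pi) * fps_expansion (Arcsin \<circ> \<omega>) 0)"
  proof (rule fps_expansion_eq_near_0)
    show "(\<lambda>z. z * deriv f z) has_fps_expansion fps_X * fps_deriv (fps_expansion f 0)"
      by (intro fps_expansion_intros F)
    show "(\<lambda>z. f z * (1 + 2 / of_real pi * (Arcsin \<circ> \<omega>) z)) has_fps_expansion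
       fps_expansion f 0 * (1 + fps_const (2 / of_real pi) * fps_expansion (Arcsin \<circ> \<omega>) 0)"
      by (intro fps_expansion_intros F P)
    have "\<forall>\<^sub>F z in nhds 0. z \<in> unit_disc"
      by (rule eventually_nhds_in_open) auto
    then show "\<forall>\<^sub>F z in nhds 0. z * deriv f z = f z * (1 + 2 / of_real pi * (Arcsin \<circ> \<omega>) z)"
      by eventually_elim (rule ode)
  qed
  with \<omega>(1) show thesis by (rule that)
qed

text \<open>The differential equation gives the recursion
  \<open>(n - 1) a_n = b * (a_1 p_(n-1) + ... + a_(n-1) p_1)\<close>. In
  \<open>a_2 a_4 - a_3^2\<close> the terms in \<open>b^3 p_1^2 p_2\<close> cancel.\<close>

lemma hankel_2_2_eq:
  fixes P :: "complex fps"
  assumes "taylor_coeff f 0 = 0" "taylor_coeff f 1 = 1"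
    and "fps_X * fps_deriv (fps_expansion f 0) = fps_expansion f 0 * (1 + fps_const b * P)"
    and "P $ 0 = 0"
  shows "hankel_2_2 f = b\<^sup>2 * (P $ 1 * P $ 3 / 3 - (P $ 2)\<^sup>2 / 4) - b ^ 4 * (P $ 1) ^ 4 / 12"
proof -
  define A where "A = fps_expansion f 0"
  have A: "A $ 0 = 0" "A $ 1 = 1"
    using assms by (simp_all add: A_def taylor_coeff_def)
  have eq: "(fps_X * fps_deriv A) $ n = (A * (1 + fps_const b * P)) $ n" for n
    using assms(3) by (simp add: A_def)
  have A2: "A $ 2 = b * P $ 1"
    using eq[of 2] A assms(4) by (simp add: fps_coeff_simps)
  have A3: "A $ 3 = (b * P $ 2 + A $ 2 * (b * P $ 1)) / 2"
    using eq[of 3] A assms(4) by (simp add: fps_coeff_simps field_simps)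
  have A4: "A $ 4 = (b * P $ 3 + A $ 2 * (b * P $ 2) + A $ 3 * (b * P $ 1)) / 3"
    using eq[of 4] A assms(4) by (simp add: fps_coeff_simps field_simps)
  show ?thesis
    unfolding hankel_2_2_def taylor_coeff_def A_def[symmetric] A4 A3 A2
    by (simp add: field_simps power2_eq_square power4_eq_xxxx)
qed

theorem theorem3p2:
  fixes f :: "complex \<Rightarrow> complex"
  assumes "f \<in> S_star_arcsin"
  shows "norm (hankel_2_2 f) \<le> 1 / pi\<^sup>2"
proof -
  obtain \<omega> where \<omega>: "schwarz_function \<omega>" and eq:
    "fps_X * fps_deriv (fps_expansion f 0) =
       fps_expansion f 0 * (1 + fps_const (2 / of_real pi) * fps_expansion (Arcsin \<circ> \<omega>) 0)"
    using S_star_arcsin_expansion[OF assms] by blast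
  note P = Arcsin_schwarz_coeffs[OF \<omega>]
  have f01: "taylor_coeff f 0 = 0" "taylor_coeff f 1 = 1"
    using assms by (auto simp: S_star_arcsin_def class_S_def class_A_def)
  define c1 c2 c3 where "c1 = taylor_coeff \<omega> 1" and "c2 = taylor_coeff \<omega> 2" and "c3 = taylor_coeff \<omega> 3"
  \<comment> \<open>Here \<open>2/9\<close> is \<open>4/3\<close> times the \<open>1/6\<close> from
    the cubic term of \<open>Arcsin\<close>, and \<open>4 / (3 * pi^2)\<close> comes from
    \<open>b^4 / 12\<close> with \<open>b = 2/pi\<close>, after multiplication by
    \<open>pi^2\<close>.\<close>
  define k where "k = 2/9 - 4 / (3 * pi\<^sup>2)"
  \<comment> \<open>The condition \<open>0 \<le> k\<close> is equivalent to
    \<open>pi^2 \<ge> 6\<close>.\<close>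
  have pi2: "pi\<^sup>2 \<ge> 6"
    using power_mono[of 3 pi 2] pi_gt3 by simp
  have k: "0 \<le> k" "k \<le> 1/3"
    using pi2 by (auto simp: k_def field_simps)
  have "hankel_2_2 f = of_real (1 / pi\<^sup>2) * (4/3 * c1 * c3 - c2\<^sup>2 + of_real k * c1 ^ 4)"
    unfolding hankel_2_2_eq[OF f01 eq P(2)] P(3,4,5) c1_def c2_def c3_def k_def
    by (simp add: field_simps power2_eq_square power3_eq_cube power4_eq_xxxx)
  moreover have "norm (4/3 * c1 * c3 - c2\<^sup>2 + of_real k * c1 ^ 4) \<le> 1"
    unfolding c1_def c2_def c3_def
    by (rule schwarz_function_coeffs[OF \<omega>]) (rule schwarz_functional_bound[OF _ _ _ k])
  ultimately show ?thesis
    using mult_left_mono[of _ 1 "1 / pi\<^sup>2"] by (simp add: norm_mult norm_divide norm_power)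
qed

end
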